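(* Let $\xi\in\mathbb Z\setminus\{0\}$ and let $\mathcal P$ be a set of prime numbers such that \[ \limsup_{n\to\infty} c^n\, n!\prod_{p\in\mathcal P}|n!|_p^2=0, \qquad\text{where}\quad c=c(\xi;\mathcal P):=4|\xi|\prod_{p\in\mathcal P}|\xi|_p^2 . \] Then either there exists a prime $p\in\mathcal P$ for which $E_p(\xi)$ is irrational, or there are two distinct primes $p,q\in\mathcal P$ such that $E_p(\xi),E_q(\xi)\in\mathbb Q$ and $E_p(\xi)\ne E_q(\xi)$.
   Context: For a prime $p$, $|\cdot|_p$ denotes the $p$-adic absolute value on $\mathbb Q$ (normalized by $|p|_p=1/p$) and $|\cdot|$ the usual absolute value. Euler's factorial series is the formal power series $E(z)=\sum_{k=0}^\infty k!\,(-z)^k$. For a prime $p$ and $\xi\in\mathbb Z$, the series $\sum_{k=0}^\infty k!\,(-\xi)^k$ converges in the $p$-adic numbers $\mathbb Q_p$; its sum is denoted $E_p(\xi)\in\mathbb Q_p$. (Note that $|n!|_p=1$ for $p>n$, so the product over $\mathcal P$ in the hypothesis is a finite product for each $n$.) *)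

theory Defs
  imports
    "HOL-Analysis.Analysis"
    "HOL-Computational_Algebra.Primes"
    "HOL-Algebra.QuotRing"
begin

definition padic_abs :: "nat \<Rightarrow> rat \<Rightarrow> real" where
  "padic_abs p x =
     (if x = 0 then 0
      else case quotient_of x of (a, b) \<Rightarrow>
        real p powi (int (multiplicity (int p) b) - int (multiplicity (int p) a)))"

definition padic_Cauchy :: "nat \<Rightarrow> (nat \<Rightarrow> rat) \<Rightarrow> bool" where
  "padic_Cauchy p X \<longleftrightarrow> (\<forall>e>0. \<exists>N. \<forall>m\<ge>N. \<forall>n\<ge>N. padic_abs p (X m - X n) < e)"

definition padic_Cauchy_ring :: "nat \<Rightarrow> (nat \<Rightarrow> rat) ring" where
  "padic_Cauchy_ring p =
     \<lparr>carrier = {X. padic_Cauchy p X}, mult = (\<lambda>X Y n. X n * Y n), one = (\<lambda>_. 1),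
      zero = (\<lambda>_. 0), add = (\<lambda>X Y n. X n + Y n)\<rparr>"

definition padic_null_seqs :: "nat \<Rightarrow> (nat \<Rightarrow> rat) set" where
  "padic_null_seqs p = {X. (\<lambda>n. padic_abs p (X n)) \<longlonglongrightarrow> 0}"

text \<open>
  The field of \<open>p\<close>-adic numbers is the completion of the rationals with respect to
  \<^const>\<open>padic_abs\<close>: Cauchy sequences modulo null sequences. As \<open>p\<close> ranges over a set of
  primes in one formula, the completions are rings with explicit carriers rather than types.
\<close>

definition padic_field :: "nat \<Rightarrow> (nat \<Rightarrow> rat) set ring" where
  "padic_field p = padic_Cauchy_ring p Quot padic_null_seqs p"

definition padic_of_rat :: "nat \<Rightarrow> rat \<Rightarrow> (nat \<Rightarrow> rat) set" where
  "padic_of_rat p r = padic_null_seqs p +>\<^bsub>padic_Cauchy_ring p\<^esub> (\<lambda>_. r)"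

definition padic_norm :: "nat \<Rightarrow> (nat \<Rightarrow> rat) set \<Rightarrow> real" where
  "padic_norm p x = (THE r. \<forall>X\<in>x. (\<lambda>n. padic_abs p (X n)) \<longlonglongrightarrow> r)"

definition padic_sums :: "nat \<Rightarrow> (nat \<Rightarrow> (nat \<Rightarrow> rat) set) \<Rightarrow> (nat \<Rightarrow> rat) set \<Rightarrow> bool" where
  "padic_sums p f s \<longleftrightarrow> s \<in> carrier (padic_field p) \<and>
     (\<lambda>n. padic_norm p (finsum (padic_field p) f {..<n} \<ominus>\<^bsub>padic_field p\<^esub> s)) \<longlonglongrightarrow> 0"

definition padic_suminf :: "nat \<Rightarrow> (nat \<Rightarrow> (nat \<Rightarrow> rat) set) \<Rightarrow> (nat \<Rightarrow> rat) set" where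
  "padic_suminf p f = (THE s. padic_sums p f s)"

definition padic_irrational :: "nat \<Rightarrow> (nat \<Rightarrow> rat) set \<Rightarrow> bool" where
  "padic_irrational p x \<longleftrightarrow> x \<in> carrier (padic_field p) - range (padic_of_rat p)"

definition Euler_padic :: "nat \<Rightarrow> int \<Rightarrow> (nat \<Rightarrow> rat) set" where
  "Euler_padic p \<xi> = padic_suminf p (\<lambda>k. padic_of_rat p (of_int (fact k * (- \<xi>) ^ k)))"

text \<open>
  The product over a possibly infinite set of primes is \<^const>\<open>prod'\<close>, which multiplies
  the factors different from \<open>1\<close>; plain \<^const>\<open>prod\<close> is constantly \<open>1\<close> on infinite sets.
  For \<open>x \<noteq> 0\<close> only finitely many factors differ from \<open>1\<close>
  (lemma \<open>finite_padic_abs_neq_1\<close> below).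
\<close>

definition padic_abs_sq_prod :: "nat set \<Rightarrow> rat \<Rightarrow> real" where
  "padic_abs_sq_prod P x = prod' (\<lambda>p. (padic_abs p x)\<^sup>2) P"

definition Euler_c :: "int \<Rightarrow> nat set \<Rightarrow> real" where
  "Euler_c \<xi> P = 4 * \<bar>real_of_int \<xi>\<bar> * padic_abs_sq_prod P (of_int \<xi>)"


subsection \<open>The \<open>p\<close>-adic absolute value\<close>

lemma padic_abs_frac:
  assumes p: "prime p" and a: "a \<noteq> 0" and b: "b \<noteq> 0"
  shows "padic_abs p (of_int a / of_int b) =
    real p powi (int (multiplicity (int p) b) - int (multiplicity (int p) a))"
proof -
  have pe: "prime_elem (int p)" using p by simp
  obtain c d where q: "quotient_of (of_int a / of_int b) = (c, d)" by fastforce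
  have d: "d > 0" using q by (rule quotient_of_denom_pos)
  have eq: "(of_int a / of_int b :: rat) = of_int c / of_int d" using q by (rule quotient_of_div)
  then have c: "c \<noteq> 0" using a b d by (auto simp: field_simps)
  have "(of_int (a * d) :: rat) = of_int (c * b)" using eq b d by (simp add: field_simps)
  then have "a * d = c * b" by (simp only: of_int_eq_iff)
  then have "multiplicity (int p) (a * d) = multiplicity (int p) (c * b)" by simp
  then have "multiplicity (int p) a + multiplicity (int p) d =
      multiplicity (int p) c + multiplicity (int p) b"
    using a b c d pe by (simp add: prime_elem_multiplicity_mult_distrib)
  then have "int (multiplicity (int p) d) - int (multiplicity (int p) c) =
      int (multiplicity (int p) b) - int (multiplicity (int p) a)" by linarith
  then show ?thesis using a b q by (simp add: padic_abs_def)
qed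

lemma padic_abs_of_int:
  assumes "prime p" "a \<noteq> 0"
  shows "padic_abs p (of_int a) = real p powi (- int (multiplicity (int p) a))"
  using padic_abs_frac[OF assms, of 1] by simp

lemma padic_abs_0 [simp]: "padic_abs p 0 = 0"
  by (simp add: padic_abs_def)

lemma padic_abs_1 [simp]: "padic_abs p 1 = 1"
  by (simp add: padic_abs_def)

lemma padic_abs_nonneg [simp]: "padic_abs p x \<ge> 0"
  by (auto simp: padic_abs_def split: prod.splits)

lemma rat_frac_cases:
  fixes x :: rat
  obtains a b where "b \<noteq> 0" "x = of_int a / of_int b"
  by (metis quotient_of_denom_pos quotient_of_div less_irrefl surj_pair)

lemma padic_abs_eq_0_iff [simp]: "prime p \<Longrightarrow> padic_abs p x = 0 \<longleftrightarrow> x = 0"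
  by (auto simp: padic_abs_def split: prod.splits)

lemma padic_abs_self: "prime p \<Longrightarrow> padic_abs p (of_nat p) = 1 / real p"
  using padic_abs_of_int[of p "int p"]
  by (auto simp: power_int_minus inverse_eq_divide)

lemma padic_abs_mult:
  assumes p: "prime p"
  shows "padic_abs p (x * y) = padic_abs p x * padic_abs p y"
proof (cases "x = 0 \<or> y = 0")
  case False
  obtain a b where x: "b \<noteq> 0" "x = of_int a / of_int b" by (rule rat_frac_cases)
  obtain c d where y: "d \<noteq> 0" "y = of_int c / of_int d" by (rule rat_frac_cases)
  have nz: "a \<noteq> 0" "c \<noteq> 0" using False x y by auto
  have pe: "prime_elem (int p)" "real p \<noteq> 0" using p by auto
  have xy: "x * y = of_int (a * c) / of_int (b * d)" using x y by simp
  have "padic_abs p (x * y) =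
      real p powi (int (multiplicity (int p) (b * d)) - int (multiplicity (int p) (a * c)))"
    unfolding xy by (rule padic_abs_frac) (use p x y nz in auto)
  also have "\<dots> = real p powi ((int (multiplicity (int p) b) - int (multiplicity (int p) a))
      + (int (multiplicity (int p) d) - int (multiplicity (int p) c)))"
    using pe x y nz by (simp add: prime_elem_multiplicity_mult_distrib algebra_simps)
  also have "\<dots> = padic_abs p x * padic_abs p y"
    using pe x y nz p by (simp add: power_int_add padic_abs_frac)
  finally show ?thesis .
qed auto

lemma padic_abs_minus:
  assumes p: "prime p" shows "padic_abs p (- x) = padic_abs p x"
proof -
  have "padic_abs p (-1) * padic_abs p (-1) = 1"
    using padic_abs_mult[OF p, of "-1" "-1"] by simp
  then have "(padic_abs p (-1))\<^sup>2 = 1" by (simp add: power2_eq_square)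
  then have "padic_abs p (-1) = 1"
    by (metis padic_abs_nonneg power2_eq_1_iff le_minus_one_simps(3))
  then show ?thesis using padic_abs_mult[OF p, of "-1" x] by simp
qed

lemma padic_abs_diff_commute: "prime p \<Longrightarrow> padic_abs p (x - y) = padic_abs p (y - x)"
  by (metis minus_diff_eq padic_abs_minus)

lemma padic_abs_of_int_le_powi:
  assumes p: "prime p" and dvd: "int p ^ j dvd a"
  shows "padic_abs p (of_int a) \<le> real p powi (- int j)"
proof (cases "a = 0")
  case False
  have "real p \<ge> 1" using prime_ge_1_nat[OF p] by simp
  moreover have "j \<le> multiplicity (int p) a"
    using False dvd p by (intro multiplicity_geI) auto
  ultimately show ?thesis
    using False p by (simp add: padic_abs_of_int power_int_increasing)
qed auto

lemma padic_abs_add_ultra: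
  assumes p: "prime p"
  shows "padic_abs p (x + y) \<le> max (padic_abs p x) (padic_abs p y)"
proof (cases "x = 0 \<or> y = 0 \<or> x + y = 0")
  case False
  obtain a b where x: "b \<noteq> 0" "x = of_int a / of_int b" by (rule rat_frac_cases)
  obtain c d where y: "d \<noteq> 0" "y = of_int c / of_int d" by (rule rat_frac_cases)
  let ?m = "multiplicity (int p)"
  define u v w where "u = a * d" and "v = c * b" and "w = b * d"
  have w: "w \<noteq> 0" using x y by (simp add: w_def)
  have xu: "x = of_int u / of_int w" and yv: "y = of_int v / of_int w"
    using x y by (auto simp: u_def v_def w_def)
  have xyw: "x + y = of_int (u + v) / of_int w"
    by (simp add: xu yv add_divide_distrib)
  have nz: "u \<noteq> 0" "v \<noteq> 0" "u + v \<noteq> 0" using False xu yv xyw by auto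
  have "int p ^ min (?m u) (?m v) dvd u + v"
    by (intro dvd_add multiplicity_dvd') auto
  then have "min (?m u) (?m v) \<le> ?m (u + v)"
    using nz p by (intro multiplicity_geI) auto
  then have disj: "?m u \<le> ?m (u + v) \<or> ?m v \<le> ?m (u + v)" by linarith
  have p1: "real p \<ge> 1" using prime_ge_1_nat[OF p] by simp
  have 1: "padic_abs p x = real p powi (int (?m w) - int (?m u))"
    unfolding xu using padic_abs_frac p nz w by blast
  have 2: "padic_abs p y = real p powi (int (?m w) - int (?m v))"
    unfolding yv using padic_abs_frac p nz w by blast
  have 3: "padic_abs p (x + y) = real p powi (int (?m w) - int (?m (u + v)))"
    unfolding xyw using padic_abs_frac p nz w by blast
  from disj show ?thesis
  proof
    assume "?m u \<le> ?m (u + v)"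
    then have "padic_abs p (x + y) \<le> padic_abs p x"
      unfolding 1 3 using p1 by (intro power_int_increasing) auto
    then show ?thesis by linarith
  next
    assume "?m v \<le> ?m (u + v)"
    then have "padic_abs p (x + y) \<le> padic_abs p y"
      unfolding 2 3 using p1 by (intro power_int_increasing) auto
    then show ?thesis by linarith
  qed
qed (auto simp: max_def)

lemma padic_abs_triangle:
  "prime p \<Longrightarrow> padic_abs p (x + y) \<le> padic_abs p x + padic_abs p y"
  using padic_abs_add_ultra[of p x y] padic_abs_nonneg[of p x] padic_abs_nonneg[of p y]
  by linarith

lemma padic_abs_triangle_diff:
  "prime p \<Longrightarrow> padic_abs p (x - z) \<le> padic_abs p (x - y) + padic_abs p (y - z)"
  using padic_abs_triangle[of p "x - y" "y - z"] by simp

lemma padic_abs_reverse_triangle: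
  "prime p \<Longrightarrow> \<bar>padic_abs p x - padic_abs p y\<bar> \<le> padic_abs p (x - y)"
  using padic_abs_triangle[of p "x - y" y] padic_abs_triangle[of p "y - x" x]
    padic_abs_diff_commute[of p x y] by simp

lemma finite_padic_abs_neq_1:
  assumes x: "x \<noteq> 0" and P: "\<forall>p\<in>P. prime p"
  shows "finite {p \<in> P. padic_abs p x \<noteq> 1}"
proof -
  obtain a b where ab: "b \<noteq> 0" "x = of_int a / of_int b" by (rule rat_frac_cases)
  have a: "a \<noteq> 0" using x ab by auto
  have "{p \<in> P. padic_abs p x \<noteq> 1} \<subseteq> {p. p dvd nat \<bar>a\<bar>} \<union> {p. p dvd nat \<bar>b\<bar>}"
  proof safe
    fix p assume p: "p \<in> P" "padic_abs p x \<noteq> 1" "\<not> p dvd nat \<bar>b\<bar>"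
    show "p dvd nat \<bar>a\<bar>"
    proof (rule ccontr)
      assume "\<not> p dvd nat \<bar>a\<bar>"
      then have "\<not> int p dvd a" "\<not> int p dvd b" using p by (auto simp: int_dvd_int_iff[symmetric])
      then have "multiplicity (int p) a = 0" "multiplicity (int p) b = 0"
        by (auto intro: not_dvd_imp_multiplicity_0)
      then have "padic_abs p x = 1"
        using padic_abs_frac[of p a b] P p a ab by simp
      with p show False by simp
    qed
  qed
  moreover have "finite {p. p dvd nat \<bar>a\<bar>}" "finite {p. p dvd nat \<bar>b\<bar>}"
    using a ab finite_divisors_nat[of "nat \<bar>a\<bar>"] finite_divisors_nat[of "nat \<bar>b\<bar>"] by simp_all
  ultimately show ?thesis by (meson finite_UnI finite_subset)
qed


subsection \<open>The field of \<open>p\<close>-adic numbers\<close>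

lemma padic_CauchyD:
  assumes "padic_Cauchy p X" "e > 0"
  obtains N where "\<And>m n. m \<ge> N \<Longrightarrow> n \<ge> N \<Longrightarrow> padic_abs p (X m - X n) < e"
  using assms unfolding padic_Cauchy_def by meson

lemma padic_Cauchy_const: "padic_Cauchy p (\<lambda>_. r)"
  by (auto simp: padic_Cauchy_def)

lemma padic_Cauchy_add:
  assumes p: "prime p" and X: "padic_Cauchy p X" and Y: "padic_Cauchy p Y"
  shows "padic_Cauchy p (\<lambda>n. X n + Y n)"
  unfolding padic_Cauchy_def
proof (intro allI impI)
  fix e :: real assume e: "e > 0"
  obtain M where M: "\<And>m n. m \<ge> M \<Longrightarrow> n \<ge> M \<Longrightarrow> padic_abs p (X m - X n) < e"
    using padic_CauchyD[OF X e] by blast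
  obtain N where N: "\<And>m n. m \<ge> N \<Longrightarrow> n \<ge> N \<Longrightarrow> padic_abs p (Y m - Y n) < e"
    using padic_CauchyD[OF Y e] by blast
  have "padic_abs p (X m + Y m - (X n + Y n)) < e" if "m \<ge> max M N" "n \<ge> max M N" for m n
  proof -
    have "X m + Y m - (X n + Y n) = (X m - X n) + (Y m - Y n)" by simp
    then have "padic_abs p (X m + Y m - (X n + Y n)) \<le>
        max (padic_abs p (X m - X n)) (padic_abs p (Y m - Y n))"
      using padic_abs_add_ultra[OF p] by metis
    then show ?thesis using M[of m n] N[of m n] that by auto
  qed
  then show "\<exists>N. \<forall>m\<ge>N. \<forall>n\<ge>N. padic_abs p (X m + Y m - (X n + Y n)) < e" by blast
qed

lemma padic_Cauchy_abs_convergent: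
  assumes p: "prime p" and X: "padic_Cauchy p X"
  shows "convergent (\<lambda>n. padic_abs p (X n))"
proof -
  have "Cauchy (\<lambda>n. padic_abs p (X n))"
    unfolding Cauchy_def
  proof (intro allI impI)
    fix e :: real assume e: "e > 0"
    obtain M where M: "\<And>m n. m \<ge> M \<Longrightarrow> n \<ge> M \<Longrightarrow> padic_abs p (X m - X n) < e"
      using padic_CauchyD[OF X e] by blast
    have "dist (padic_abs p (X m)) (padic_abs p (X n)) < e" if "m \<ge> M" "n \<ge> M" for m n
      using padic_abs_reverse_triangle[OF p, of "X m" "X n"] M[OF that] by (simp add: dist_real_def)
    then show "\<exists>M. \<forall>m\<ge>M. \<forall>n\<ge>M. dist (padic_abs p (X m)) (padic_abs p (X n)) < e" by blast
  qed
  then show ?thesis by (simp add: Cauchy_convergent_iff)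
qed

lemma padic_Cauchy_bounded:
  assumes p: "prime p" and X: "padic_Cauchy p X"
  obtains B where "B > 0" "\<And>n. padic_abs p (X n) \<le> B"
proof -
  have "Bseq (\<lambda>n. padic_abs p (X n))"
    using padic_Cauchy_abs_convergent[OF assms] by (rule convergent_imp_Bseq)
  then show ?thesis using that by (auto simp: Bseq_def)
qed

lemma padic_Cauchy_mult:
  assumes p: "prime p" and X: "padic_Cauchy p X" and Y: "padic_Cauchy p Y"
  shows "padic_Cauchy p (\<lambda>n. X n * Y n)"
  unfolding padic_Cauchy_def
proof (intro allI impI)
  fix e :: real assume e: "e > 0"
  obtain B where B: "B > 0" "\<And>n. padic_abs p (X n) \<le> B" using padic_Cauchy_bounded[OF p X] by blast
  obtain C where C: "C > 0" "\<And>n. padic_abs p (Y n) \<le> C" using padic_Cauchy_bounded[OF p Y] by blast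
  obtain M where M: "\<And>m n. m \<ge> M \<Longrightarrow> n \<ge> M \<Longrightarrow> padic_abs p (X m - X n) < e / C"
    using padic_CauchyD[OF X, of "e / C"] e C by auto
  obtain N where N: "\<And>m n. m \<ge> N \<Longrightarrow> n \<ge> N \<Longrightarrow> padic_abs p (Y m - Y n) < e / B"
    using padic_CauchyD[OF Y, of "e / B"] e B by auto
  have "padic_abs p (X m * Y m - X n * Y n) < e" if mn: "m \<ge> max M N" "n \<ge> max M N" for m n
  proof -
    have eq: "X m * Y m - X n * Y n = (X m - X n) * Y m + X n * (Y m - Y n)"
      by (simp add: algebra_simps)
    have "padic_abs p ((X m - X n) * Y m) \<le> padic_abs p (X m - X n) * C"
      using C by (auto simp: padic_abs_mult[OF p] intro: mult_left_mono)
    also have "\<dots> < e" using M[of m n] mn C by (simp add: field_simps)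
    finally have 1: "padic_abs p ((X m - X n) * Y m) < e" .
    have "padic_abs p (X n * (Y m - Y n)) \<le> B * padic_abs p (Y m - Y n)"
      using B by (auto simp: padic_abs_mult[OF p] intro: mult_right_mono)
    also have "\<dots> < e" using N[of m n] mn B by (simp add: field_simps)
    finally have 2: "padic_abs p (X n * (Y m - Y n)) < e" .
    show ?thesis unfolding eq using padic_abs_add_ultra[OF p] 1 2 by (meson le_less_trans max_less_iff_conj)
  qed
  then show "\<exists>N. \<forall>m\<ge>N. \<forall>n\<ge>N. padic_abs p (X m * Y m - X n * Y n) < e" by blast
qed

lemma padic_Cauchy_minus:
  assumes p: "prime p" and X: "padic_Cauchy p X"
  shows "padic_Cauchy p (\<lambda>n. - X n)"
  using padic_Cauchy_mult[OF p padic_Cauchy_const[of p "-1"] X] by simp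

lemma padic_null_Cauchy:
  assumes p: "prime p" and X: "X \<in> padic_null_seqs p"
  shows "padic_Cauchy p X"
  unfolding padic_Cauchy_def
proof (intro allI impI)
  fix e :: real assume e: "e > 0"
  then obtain N where N: "\<And>n. n \<ge> N \<Longrightarrow> padic_abs p (X n) < e"
    using X LIMSEQ_D[of "\<lambda>n. padic_abs p (X n)" 0 e] by (auto simp: padic_null_seqs_def)
  have "padic_abs p (X m - X n) < e" if "m \<ge> N" "n \<ge> N" for m n
    using padic_abs_add_ultra[OF p, of "X m" "- X n"] N[of m] N[of n] that
    by (auto simp: padic_abs_minus[OF p])
  then show "\<exists>N. \<forall>m\<ge>N. \<forall>n\<ge>N. padic_abs p (X m - X n) < e" by blast
qed

lemma padic_null_add:
  assumes p: "prime p" and X: "X \<in> padic_null_seqs p" and Y: "Y \<in> padic_null_seqs p"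
  shows "(\<lambda>n. X n + Y n) \<in> padic_null_seqs p"
proof -
  have "(\<lambda>n. padic_abs p (X n) + padic_abs p (Y n)) \<longlonglongrightarrow> 0"
    using X Y tendsto_add[of _ 0 _ _ 0] by (fastforce simp: padic_null_seqs_def)
  then have "(\<lambda>n. padic_abs p (X n + Y n)) \<longlonglongrightarrow> 0"
    by (rule Lim_null_comparison[rotated]) (auto simp: padic_abs_triangle[OF p])
  then show ?thesis by (simp add: padic_null_seqs_def)
qed

lemma padic_null_mult:
  assumes p: "prime p" and X: "padic_Cauchy p X" and Y: "Y \<in> padic_null_seqs p"
  shows "(\<lambda>n. X n * Y n) \<in> padic_null_seqs p"
proof -
  obtain B where B: "B > 0" "\<And>n. padic_abs p (X n) \<le> B" using padic_Cauchy_bounded[OF p X] by blast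
  have "(\<lambda>n. B * padic_abs p (Y n)) \<longlonglongrightarrow> 0"
    using Y by (auto simp: padic_null_seqs_def intro: tendsto_mult_right_zero)
  then have "(\<lambda>n. padic_abs p (X n * Y n)) \<longlonglongrightarrow> 0"
    by (rule Lim_null_comparison[rotated])
      (auto simp: padic_abs_mult[OF p] B intro!: always_eventually mult_right_mono)
  then show ?thesis by (simp add: padic_null_seqs_def)
qed

lemma padic_null_minus:
  assumes p: "prime p" and X: "X \<in> padic_null_seqs p"
  shows "(\<lambda>n. - X n) \<in> padic_null_seqs p"
  using X by (simp add: padic_null_seqs_def padic_abs_minus[OF p])

lemma padic_Cauchy_ring_simps:
  "carrier (padic_Cauchy_ring p) = {X. padic_Cauchy p X}"
  "X \<otimes>\<^bsub>padic_Cauchy_ring p\<^esub> Y = (\<lambda>n. X n * Y n)"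
  "\<one>\<^bsub>padic_Cauchy_ring p\<^esub> = (\<lambda>_. 1)"
  "\<zero>\<^bsub>padic_Cauchy_ring p\<^esub> = (\<lambda>_. 0)"
  "X \<oplus>\<^bsub>padic_Cauchy_ring p\<^esub> Y = (\<lambda>n. X n + Y n)"
  by (simp_all add: padic_Cauchy_ring_def)

lemma padic_Cauchy_ring_cring:
  assumes p: "prime p" shows "cring (padic_Cauchy_ring p)"
proof (rule cringI)
  show "abelian_group (padic_Cauchy_ring p)"
  proof (rule abelian_groupI)
    fix X assume "X \<in> carrier (padic_Cauchy_ring p)"
    then show "\<exists>Y\<in>carrier (padic_Cauchy_ring p).
        Y \<oplus>\<^bsub>padic_Cauchy_ring p\<^esub> X = \<zero>\<^bsub>padic_Cauchy_ring p\<^esub>"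
      by (intro bexI[of _ "\<lambda>n. - X n"])
        (auto simp: padic_Cauchy_ring_simps padic_Cauchy_minus[OF p])
  qed (auto simp: padic_Cauchy_ring_simps padic_Cauchy_add[OF p] padic_Cauchy_const algebra_simps)
  show "comm_monoid (padic_Cauchy_ring p)"
    by (rule comm_monoidI)
      (auto simp: padic_Cauchy_ring_simps padic_Cauchy_mult[OF p] padic_Cauchy_const algebra_simps)
qed (auto simp: padic_Cauchy_ring_simps algebra_simps)

lemma padic_Cauchy_ring_a_inv:
  assumes p: "prime p" and X: "padic_Cauchy p X"
  shows "\<ominus>\<^bsub>padic_Cauchy_ring p\<^esub> X = (\<lambda>n. - X n)"
proof -
  interpret cring "padic_Cauchy_ring p" by (rule padic_Cauchy_ring_cring[OF p])
  show ?thesis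
    by (rule minus_equality)
      (use X in \<open>auto simp: padic_Cauchy_ring_simps padic_Cauchy_minus[OF p]\<close>)
qed

lemma padic_null_seqs_ideal:
  assumes p: "prime p" shows "ideal (padic_null_seqs p) (padic_Cauchy_ring p)"
proof -
  interpret cring "padic_Cauchy_ring p" by (rule padic_Cauchy_ring_cring[OF p])
  show ?thesis
  proof (rule idealI)
    show "ring (padic_Cauchy_ring p)" by (rule ring_axioms)
    show "subgroup (padic_null_seqs p) (add_monoid (padic_Cauchy_ring p))"
    proof (rule group.subgroupI)
      show "group (add_monoid (padic_Cauchy_ring p))" by (rule a_group)
      show "padic_null_seqs p \<noteq> {}"
        by (auto simp: padic_null_seqs_def intro!: exI[of _ "\<lambda>_. 0"])
      fix X assume X: "X \<in> padic_null_seqs p"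
      then have "\<ominus>\<^bsub>padic_Cauchy_ring p\<^esub> X \<in> padic_null_seqs p"
        using padic_Cauchy_ring_a_inv[OF p] padic_null_Cauchy[OF p] padic_null_minus[OF p] by simp
      then show "inv\<^bsub>add_monoid (padic_Cauchy_ring p)\<^esub> X \<in> padic_null_seqs p"
        by (simp add: a_inv_def)
    qed (auto simp: padic_Cauchy_ring_simps padic_null_Cauchy[OF p] padic_null_add[OF p])
  next
    fix X Y assume "X \<in> padic_null_seqs p" "Y \<in> carrier (padic_Cauchy_ring p)"
    then have "(\<lambda>n. Y n * X n) \<in> padic_null_seqs p"
      by (intro padic_null_mult p) (auto simp: padic_Cauchy_ring_simps)
    then show "Y \<otimes>\<^bsub>padic_Cauchy_ring p\<^esub> X \<in> padic_null_seqs p"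
      and "X \<otimes>\<^bsub>padic_Cauchy_ring p\<^esub> Y \<in> padic_null_seqs p"
      by (simp_all add: padic_Cauchy_ring_simps mult.commute)
  qed
qed

lemma padic_field_cring: "prime p \<Longrightarrow> cring (padic_field p)"
  unfolding padic_field_def
  by (intro ideal.quotient_is_cring padic_null_seqs_ideal padic_Cauchy_ring_cring)

abbreviation padic_class :: "nat \<Rightarrow> (nat \<Rightarrow> rat) \<Rightarrow> (nat \<Rightarrow> rat) set" where
  "padic_class p X \<equiv> padic_null_seqs p +>\<^bsub>padic_Cauchy_ring p\<^esub> X"

lemma padic_class_eq: "padic_class p X = {\<lambda>n. Z n + X n | Z. Z \<in> padic_null_seqs p}"
  by (auto simp: a_r_coset_def' padic_Cauchy_ring_simps)

lemma padic_class_hom: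
  assumes "prime p"
  shows "padic_class p \<in> ring_hom (padic_Cauchy_ring p) (padic_field p)"
  unfolding padic_field_def by (intro ideal.rcos_ring_hom padic_null_seqs_ideal assms)

lemma padic_field_carrier: "carrier (padic_field p) = padic_class p ` {X. padic_Cauchy p X}"
  by (auto simp: padic_field_def FactRing_def A_RCOSETS_def' padic_Cauchy_ring_simps)

lemma padic_class_eq_iff:
  assumes p: "prime p"
  shows "padic_class p X = padic_class p Y \<longleftrightarrow> (\<lambda>n. X n - Y n) \<in> padic_null_seqs p"
proof
  assume "padic_class p X = padic_class p Y"
  moreover have "X \<in> padic_class p X"
    unfolding padic_class_eq by (auto simp: padic_null_seqs_def intro!: exI[of _ "\<lambda>_. 0"])
  ultimately obtain Z where "Z \<in> padic_null_seqs p" "X = (\<lambda>n. Z n + Y n)"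
    unfolding padic_class_eq by blast
  then show "(\<lambda>n. X n - Y n) \<in> padic_null_seqs p" by simp
next
  have sub: "padic_class p X \<subseteq> padic_class p Y" if "(\<lambda>n. X n - Y n) \<in> padic_null_seqs p" for X Y
  proof
    fix W assume "W \<in> padic_class p X"
    then obtain Z where Z: "Z \<in> padic_null_seqs p" "W = (\<lambda>n. Z n + X n)"
      unfolding padic_class_eq by blast
    have "(\<lambda>n. Z n + (X n - Y n)) \<in> padic_null_seqs p" using padic_null_add[OF p Z(1) that] .
    then show "W \<in> padic_class p Y"
      unfolding padic_class_eq using Z(2) by (intro CollectI exI conjI) (assumption | auto)+
  qed
  assume XY: "(\<lambda>n. X n - Y n) \<in> padic_null_seqs p"
  then have "(\<lambda>n. Y n - X n) \<in> padic_null_seqs p" using padic_null_minus[OF p XY] by simp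
  with XY show "padic_class p X = padic_class p Y" using sub by blast
qed

lemma padic_class_diff:
  assumes p: "prime p" and X: "padic_Cauchy p X" and Y: "padic_Cauchy p Y"
  shows "padic_class p X \<ominus>\<^bsub>padic_field p\<^esub> padic_class p Y = padic_class p (\<lambda>n. X n - Y n)"
proof -
  interpret ring_hom_cring "padic_Cauchy_ring p" "padic_field p" "padic_class p"
    by (intro ring_hom_cring.intro ring_hom_cring_axioms.intro padic_Cauchy_ring_cring padic_field_cring padic_class_hom p)
  have "padic_class p (X \<oplus>\<^bsub>padic_Cauchy_ring p\<^esub> (\<ominus>\<^bsub>padic_Cauchy_ring p\<^esub> Y)) =
      padic_class p X \<ominus>\<^bsub>padic_field p\<^esub> padic_class p Y"
    using X Y hom_add[of X "\<ominus>\<^bsub>padic_Cauchy_ring p\<^esub> Y"] hom_a_inv[of Y] R.a_inv_closed[of Y]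
    by (simp add: padic_Cauchy_ring_simps(1) S.minus_eq)
  then show ?thesis
    by (simp add: padic_Cauchy_ring_a_inv[OF p Y] padic_Cauchy_ring_simps)
qed

lemma padic_norm_class:
  assumes p: "prime p" and X: "padic_Cauchy p X"
  shows "(\<lambda>n. padic_abs p (X n)) \<longlonglongrightarrow> padic_norm p (padic_class p X)"
proof -
  obtain r where r: "(\<lambda>n. padic_abs p (X n)) \<longlonglongrightarrow> r"
    using padic_Cauchy_abs_convergent[OF assms] by (auto simp: convergent_def)
  have all: "(\<lambda>n. padic_abs p (Y n)) \<longlonglongrightarrow> r" if Y: "Y \<in> padic_class p X" for Y
  proof -
    obtain Z where Z: "Z \<in> padic_null_seqs p" "Y = (\<lambda>n. Z n + X n)"
      using Y unfolding padic_class_eq by blast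
    have "(\<lambda>n. padic_abs p (Y n) - padic_abs p (X n)) \<longlonglongrightarrow> 0"
    proof (rule Lim_null_comparison)
      show "(\<lambda>n. padic_abs p (Z n)) \<longlonglongrightarrow> 0" using Z by (simp add: padic_null_seqs_def)
      show "\<forall>\<^sub>F n in sequentially. norm (padic_abs p (Y n) - padic_abs p (X n)) \<le> padic_abs p (Z n)"
        using padic_abs_reverse_triangle[OF p, of "Y n" "X n" for n] Z by auto
    qed
    from tendsto_add[OF this r] show ?thesis by simp
  qed
  have "X \<in> padic_class p X"
    unfolding padic_class_eq by (auto simp: padic_null_seqs_def intro!: exI[of _ "\<lambda>_. 0"])
  then have "padic_norm p (padic_class p X) = r"
    unfolding padic_norm_def using all LIMSEQ_unique by (intro the_equality) blast+
  with r show ?thesis by simp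
qed

lemma padic_of_rat_hom:
  assumes p: "prime p"
  shows "padic_of_rat p r \<in> carrier (padic_field p)"
    and "padic_of_rat p (r + s) = padic_of_rat p r \<oplus>\<^bsub>padic_field p\<^esub> padic_of_rat p s"
    and "padic_of_rat p (r * s) = padic_of_rat p r \<otimes>\<^bsub>padic_field p\<^esub> padic_of_rat p s"
    and "padic_of_rat p 1 = \<one>\<^bsub>padic_field p\<^esub>"
    and "padic_of_rat p 0 = \<zero>\<^bsub>padic_field p\<^esub>"
proof -
  interpret ring_hom_cring "padic_Cauchy_ring p" "padic_field p" "padic_class p"
    by (intro ring_hom_cring.intro ring_hom_cring_axioms.intro padic_Cauchy_ring_cring padic_field_cring padic_class_hom p)
  have c: "(\<lambda>_. r) \<in> carrier (padic_Cauchy_ring p)" for r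
    by (simp add: padic_Cauchy_ring_simps padic_Cauchy_const)
  show "padic_of_rat p r \<in> carrier (padic_field p)"
    unfolding padic_of_rat_def by (rule hom_closed[OF c])
  show "padic_of_rat p (r + s) = padic_of_rat p r \<oplus>\<^bsub>padic_field p\<^esub> padic_of_rat p s"
    unfolding padic_of_rat_def using hom_add[OF c c, of r s] by (simp add: padic_Cauchy_ring_simps)
  show "padic_of_rat p (r * s) = padic_of_rat p r \<otimes>\<^bsub>padic_field p\<^esub> padic_of_rat p s"
    unfolding padic_of_rat_def using hom_mult[OF c c, of r s] by (simp add: padic_Cauchy_ring_simps)
  show "padic_of_rat p 1 = \<one>\<^bsub>padic_field p\<^esub>"
    unfolding padic_of_rat_def using hom_one by (simp add: padic_Cauchy_ring_simps)
  show "padic_of_rat p 0 = \<zero>\<^bsub>padic_field p\<^esub>"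
    unfolding padic_of_rat_def using hom_zero by (simp add: padic_Cauchy_ring_simps)
qed

lemma padic_of_rat_eq_iff:
  assumes p: "prime p" shows "padic_of_rat p r = padic_of_rat p s \<longleftrightarrow> r = s"
  unfolding padic_of_rat_def padic_class_eq_iff[OF p]
  using p by (auto simp: padic_null_seqs_def LIMSEQ_const_iff)

lemma padic_norm_of_rat: "prime p \<Longrightarrow> padic_norm p (padic_of_rat p r) = padic_abs p r"
  using padic_norm_class[OF _ padic_Cauchy_const] LIMSEQ_unique tendsto_const
  unfolding padic_of_rat_def by blast

lemma padic_null_if_eventually_0:
  "\<forall>\<^sub>F n in sequentially. X n = 0 \<Longrightarrow> X \<in> padic_null_seqs p"
  unfolding padic_null_seqs_def
  by (auto intro!: tendsto_eventually elim: eventually_mono)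

lemma padic_field_field:
  assumes p: "prime p" shows "field (padic_field p)"
proof -
  interpret ring_hom_cring "padic_Cauchy_ring p" "padic_field p" "padic_class p"
    by (intro ring_hom_cring.intro ring_hom_cring_axioms.intro padic_Cauchy_ring_cring padic_field_cring padic_class_hom p)
  show ?thesis
  proof (rule S.cring_fieldI2)
    show "\<zero>\<^bsub>padic_field p\<^esub> \<noteq> \<one>\<^bsub>padic_field p\<^esub>"
      using padic_of_rat_eq_iff[OF p, of 0 1] by (simp add: padic_of_rat_hom[OF p])
    fix x assume "x \<in> carrier (padic_field p)" and x0: "x \<noteq> \<zero>\<^bsub>padic_field p\<^esub>"
    then obtain X where X: "padic_Cauchy p X" "x = padic_class p X"
      by (auto simp: padic_field_carrier)
    define r where "r = padic_norm p x"
    have lim: "(\<lambda>n. padic_abs p (X n)) \<longlonglongrightarrow> r"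
      unfolding r_def X(2) using padic_norm_class[OF p X(1)] .
    have "r \<ge> 0" by (rule LIMSEQ_le_const[OF lim]) auto
    moreover have "r \<noteq> 0"
    proof
      assume "r = 0"
      then have "(\<lambda>n. X n - 0) \<in> padic_null_seqs p" using lim by (simp add: padic_null_seqs_def)
      then have "x = padic_of_rat p 0"
        unfolding X(2) padic_of_rat_def by (subst padic_class_eq_iff[OF p])
      with x0 show False by (simp add: padic_of_rat_hom[OF p])
    qed
    ultimately have r: "r > 0" by simp
    have "\<forall>\<^sub>F n in sequentially. r / 2 < padic_abs p (X n)"
      using order_tendstoD(1)[OF lim, of "r / 2"] r by simp
    then obtain K where K: "\<And>n. n \<ge> K \<Longrightarrow> r / 2 < padic_abs p (X n)"
      by (auto simp: eventually_sequentially)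
    define Y where "Y = (\<lambda>n. inverse (X n))"
    have nz: "X n \<noteq> 0" if "n \<ge> K" for n using K[OF that] r by auto
    have Y: "padic_Cauchy p Y"
      unfolding padic_Cauchy_def
    proof (intro allI impI)
      fix e :: real assume e: "e > 0"
      then have "e * (r / 2)\<^sup>2 > 0" using r by simp
      then obtain M where M: "\<And>m n. m \<ge> M \<Longrightarrow> n \<ge> M \<Longrightarrow> padic_abs p (X m - X n) < e * (r / 2)\<^sup>2"
        using padic_CauchyD[OF X(1)] by blast
      have "padic_abs p (Y m - Y n) < e" if mn: "m \<ge> max M K" "n \<ge> max M K" for m n
      proof -
        have "X m * X n * (Y m - Y n) = X n - X m"
          using nz[of m] nz[of n] mn by (simp add: Y_def field_simps)
        then have eq: "padic_abs p (X m) * padic_abs p (X n) * padic_abs p (Y m - Y n) =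
            padic_abs p (X n - X m)"
          by (metis padic_abs_mult[OF p])
        have "(r / 2)\<^sup>2 \<le> padic_abs p (X m) * padic_abs p (X n)"
          unfolding power2_eq_square using K[of m] K[of n] mn r by (intro mult_mono) auto
        then have "(r / 2)\<^sup>2 * padic_abs p (Y m - Y n) \<le> padic_abs p (X n - X m)"
          unfolding eq[symmetric] by (intro mult_right_mono) auto
        also have "\<dots> < e * (r / 2)\<^sup>2" using M mn by simp
        finally show ?thesis using r by (simp add: mult.commute)
      qed
      then show "\<exists>N. \<forall>m\<ge>N. \<forall>n\<ge>N. padic_abs p (Y m - Y n) < e" by blast
    qed
    have "x \<otimes>\<^bsub>padic_field p\<^esub> padic_class p Y = padic_class p (\<lambda>n. X n * Y n)"
      using hom_mult[of X Y] X Y by (simp add: padic_Cauchy_ring_simps)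
    also have "\<dots> = padic_of_rat p 1"
      unfolding padic_of_rat_def padic_class_eq_iff[OF p]
      by (rule padic_null_if_eventually_0)
        (auto simp: eventually_sequentially Y_def nz intro!: exI[of _ K])
    finally show "\<exists>y\<in>carrier (padic_field p). x \<otimes>\<^bsub>padic_field p\<^esub> y = \<one>\<^bsub>padic_field p\<^esub>"
      using Y by (auto simp: padic_field_carrier padic_of_rat_hom[OF p])
  qed
qed


subsection \<open>Convergence of Euler's factorial series\<close>

lemma finsum_padic_of_rat:
  assumes p: "prime p"
  shows "finsum (padic_field p) (\<lambda>k. padic_of_rat p (f k)) {..<n::nat} =
    padic_of_rat p (\<Sum>k<n. f k)"
proof -
  interpret cring "padic_field p" by (rule padic_field_cring[OF p])
  show ?thesis
    by (induction n)
      (simp_all add: padic_of_rat_hom[OF p] lessThan_Suc add.commute)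
qed

lemma padic_sums_of_rat_iff:
  assumes p: "prime p" and f: "padic_Cauchy p (\<lambda>n. \<Sum>k<n. f k)"
  shows "padic_sums p (\<lambda>k. padic_of_rat p (f k)) s \<longleftrightarrow> s = padic_class p (\<lambda>n. \<Sum>k<n. f k)"
proof -
  define S where "S = (\<lambda>n. \<Sum>k<n. f k)"
  have S: "padic_Cauchy p S" using f by (simp add: S_def)
  have diff: "finsum (padic_field p) (\<lambda>k. padic_of_rat p (f k)) {..<n} \<ominus>\<^bsub>padic_field p\<^esub> padic_class p X =
      padic_class p (\<lambda>m. S n - X m)" if "padic_Cauchy p X" for X n
    using padic_class_diff[OF p padic_Cauchy_const that, of "S n"]
    by (simp only: finsum_padic_of_rat[OF p] S_def) (simp only: padic_of_rat_def)
  have lim: "(\<lambda>m. padic_abs p (S n - X m)) \<longlonglongrightarrow> padic_norm p (padic_class p (\<lambda>m. S n - X m))"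
    if "padic_Cauchy p X" for X n
    using padic_Cauchy_add[OF p padic_Cauchy_const padic_Cauchy_minus[OF p that], of "S n"]
    by (intro padic_norm_class p) simp
  have "padic_sums p (\<lambda>k. padic_of_rat p (f k)) (padic_class p S)"
    unfolding padic_sums_def diff[OF S]
  proof
    show "padic_class p S \<in> carrier (padic_field p)" using S by (auto simp: padic_field_carrier)
    show "(\<lambda>n. padic_norm p (padic_class p (\<lambda>m. S n - S m))) \<longlonglongrightarrow> 0"
    proof (rule LIMSEQ_I)
      fix e :: real assume e: "e > 0"
      then obtain N where N: "\<And>m n. m \<ge> N \<Longrightarrow> n \<ge> N \<Longrightarrow> padic_abs p (S m - S n) < e / 2"
        using padic_CauchyD[OF S, of "e / 2"] by auto
      have "norm (padic_norm p (padic_class p (\<lambda>m. S n - S m)) - 0) < e" if n: "n \<ge> N" for n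
      proof -
        have "0 \<le> padic_norm p (padic_class p (\<lambda>m. S n - S m))"
          by (rule LIMSEQ_le_const[OF lim[OF S]]) auto
        moreover have "padic_norm p (padic_class p (\<lambda>m. S n - S m)) \<le> e / 2"
          by (rule LIMSEQ_le_const2[OF lim[OF S]]) (use N n in \<open>auto intro!: exI[of _ N] less_imp_le\<close>)
        ultimately show ?thesis using e by simp
      qed
      then show "\<exists>N. \<forall>n\<ge>N. norm (padic_norm p (padic_class p (\<lambda>m. S n - S m)) - 0) < e" by blast
    qed
  qed
  moreover have "s = padic_class p S" if s: "padic_sums p (\<lambda>k. padic_of_rat p (f k)) s"
  proof -
    obtain X where X: "padic_Cauchy p X" "s = padic_class p X"
      using s by (auto simp: padic_sums_def padic_field_carrier)
    have 0: "(\<lambda>n. padic_norm p (padic_class p (\<lambda>m. S n - X m))) \<longlonglongrightarrow> 0"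
      using s unfolding padic_sums_def X(2) diff[OF X(1)] by blast
    have "(\<lambda>n. padic_abs p (X n - S n)) \<longlonglongrightarrow> 0"
    proof (rule LIMSEQ_I)
      fix e :: real assume e: "e > 0"
      obtain M where M: "\<And>m n. m \<ge> M \<Longrightarrow> n \<ge> M \<Longrightarrow> padic_abs p (X m - X n) < e / 2"
        using padic_CauchyD[OF X(1), of "e / 2"] e by auto
      have "\<forall>\<^sub>F n in sequentially. padic_norm p (padic_class p (\<lambda>m. S n - X m)) < e / 2"
        using order_tendstoD(2)[OF 0, of "e / 2"] e by simp
      then obtain N where N: "\<And>n. n \<ge> N \<Longrightarrow> padic_norm p (padic_class p (\<lambda>m. S n - X m)) < e / 2"
        by (auto simp: eventually_sequentially)
      have "padic_abs p (X n - S n) < e" if n: "n \<ge> max M N" for n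
      proof -
        have "\<forall>\<^sub>F m in sequentially. padic_abs p (S n - X m) < e / 2"
          by (rule order_tendstoD(2)[OF lim[OF X(1)]]) (use N n in simp)
        then obtain K where "\<forall>m\<ge>K. padic_abs p (S n - X m) < e / 2"
          by (auto simp only: eventually_sequentially)
        then obtain m where m: "m \<ge> M" "padic_abs p (S n - X m) < e / 2"
          by (meson max.cobounded1 max.cobounded2)
        have "padic_abs p (X n - S n) \<le> padic_abs p (X n - X m) + padic_abs p (X m - S n)"
          by (rule padic_abs_triangle_diff[OF p])
        also have "\<dots> < e"
          using M[of n m] m n padic_abs_diff_commute[OF p, of "X m" "S n"] by simp
        finally show ?thesis .
      qed
      then show "\<exists>N. \<forall>n\<ge>N. norm (padic_abs p (X n - S n) - 0) < e"
        by (intro exI[of _ "max M N"]) simp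
    qed
    then show ?thesis unfolding X(2) padic_class_eq_iff[OF p] by (simp add: padic_null_seqs_def)
  qed
  ultimately show ?thesis unfolding S_def by blast
qed

lemma prime_power_dvd_fact:
  assumes "prime p" "j * p \<le> n" shows "p ^ j dvd (fact n :: nat)"
proof -
  have "p ^ j dvd (fact (j * p) :: nat)"
  proof (induction j)
    case (Suc j)
    have "p dvd (fact p :: nat)" using assms by (simp add: prime_dvd_fact_iff)
    then have "p ^ j * p dvd (fact (j * p) * fact p :: nat)" using Suc by (intro mult_dvd_mono)
    also have "\<dots> dvd fact (j * p + p)" by (rule fact_fact_dvd_fact)
    finally show ?case by (simp add: algebra_simps)
  qed simp
  also have "\<dots> dvd fact n" using assms by (intro fact_dvd)
  finally show ?thesis .
qed

lemma Euler_partial_sums_Cauchy: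
  assumes p: "prime p"
  shows "padic_Cauchy p (\<lambda>n. \<Sum>k<n. of_int (fact k * (- \<xi>) ^ k))"
  unfolding padic_Cauchy_def
proof (intro allI impI)
  fix e :: real assume e: "e > 0"
  let ?S = "\<lambda>n. \<Sum>k<n. fact k * (- \<xi>) ^ k"
  have p1: "real p > 1" using prime_gt_1_nat[OF p] by simp
  obtain j where j: "inverse (real p) ^ j < e"
    using real_arch_pow_inv[of e "inverse (real p)"] e p1 by (auto simp: field_simps)
  have *: "padic_abs p (of_int (?S m - ?S n)) < e" if mn: "m \<ge> n" "n \<ge> j * p" for m n
  proof -
    have "?S m - ?S n = (\<Sum>k=n..<m. fact k * (- \<xi>) ^ k)"
      using sum_diff_nat_ivl[of 0 n m "\<lambda>k. fact k * (- \<xi>) ^ k"] mn by (simp add: atLeast0LessThan)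
    also have "int p ^ j dvd \<dots>"
    proof (intro dvd_sum dvd_mult2)
      fix k assume "k \<in> {n..<m}"
      then have "p ^ j dvd (fact k :: nat)" using mn by (intro prime_power_dvd_fact[OF p]) auto
      then have "int (p ^ j) dvd int (fact k)" by (simp only: int_dvd_int_iff)
      then show "int p ^ j dvd fact k" by simp
    qed
    finally have "padic_abs p (of_int (?S m - ?S n)) \<le> real p powi (- int j)"
      by (rule padic_abs_of_int_le_powi[OF p])
    also have "\<dots> < e" using j by (simp add: power_int_minus power_inverse)
    finally show ?thesis .
  qed
  have "padic_abs p (of_int (?S m) - of_int (?S n)) < e" if "m \<ge> j * p" "n \<ge> j * p" for m n
  proof (cases "m \<ge> n")
    case True
    then show ?thesis using *[of n m] that by simp
  next
    case False
    then show ?thesis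
      using *[of m n] that padic_abs_diff_commute[OF p, of "of_int (?S m)" "of_int (?S n)"] by simp
  qed
  then show "\<exists>N. \<forall>m\<ge>N. \<forall>n\<ge>N. padic_abs p ((\<Sum>k<m. of_int (fact k * (- \<xi>) ^ k)) -
      (\<Sum>k<n. of_int (fact k * (- \<xi>) ^ k))) < e"
    by (intro exI[of _ "j * p"]) simp
qed

lemma Euler_padic_eq:
  assumes p: "prime p"
  shows "Euler_padic p \<xi> = padic_class p (\<lambda>n. \<Sum>k<n. of_int (fact k * (- \<xi>) ^ k))"
  unfolding Euler_padic_def padic_suminf_def
  by (rule the_equality)
    (simp_all only: padic_sums_of_rat_iff[OF p Euler_partial_sums_Cauchy[OF p]])

lemma Euler_padic_sums:
  assumes p: "prime p"
  shows "padic_sums p (\<lambda>k. padic_of_rat p (of_int (fact k * (- \<xi>) ^ k))) (Euler_padic p \<xi>)"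
  unfolding Euler_padic_eq[OF p]
  by (simp only: padic_sums_of_rat_iff[OF p Euler_partial_sums_Cauchy[OF p]])

end

theory Submission
  imports Defs
begin

text \<open>
  Contracting Euler's continued fraction for \<open>E(z)\<close> gives Pade approximants \<open>A\<^sub>n / B\<^sub>n\<close> whose
  numerators and denominators both satisfy
  \<open>y\<^sub>n\<^sub>+\<^sub>2 = (1 + (2n + 3) z) y\<^sub>n\<^sub>+\<^sub>1 - (n + 1)\<^sup>2 z\<^sup>2 y\<^sub>n\<close>. The recurrence bounds \<open>A\<^sub>n(\<xi>)\<close> and \<open>B\<^sub>n(\<xi>)\<close>
  by \<open>4\<^sup>n n! \<bar>\<xi>\<bar>\<^sup>n\<close>, and shows that consecutive approximants have determinant \<open>n!\<^sup>2 \<xi>\<^sup>2\<^sup>n \<noteq> 0\<close>.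
  The remainder \<open>B\<^sub>n E - A\<^sub>n = \<Sum>\<^sub>m (-1)\<^sup>n\<^sup>+\<^sup>m m! n! (m choose n) z\<^sup>n\<^sup>+\<^sup>m\<close> satisfies the same recurrence,
  and all its terms are divisible by \<open>n!\<^sup>2 z\<^sup>2\<^sup>n\<close>.
  If \<open>E\<^sub>p(\<xi>) = a/b\<close> for all \<open>p \<in> P\<close>, then \<open>a B\<^sub>n(\<xi>) - b A\<^sub>n(\<xi>)\<close> is an integer, nonzero for \<open>n\<close>
  or for \<open>n + 1\<close>, of \<open>p\<close>-adic size at most \<open>\<bar>n!\<^sup>2 \<xi>\<^sup>2\<^sup>n\<bar>\<^sub>p\<close> for each \<open>p \<in> P\<close>. The product formula
  then bounds \<open>c\<^sup>n n! \<Prod>\<^sub>p \<bar>n!\<bar>\<^sub>p\<^sup>2\<close> away from zero along infinitely many \<open>n\<close>.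
\<close>

subsection \<open>Pade approximants of the factorial series\<close>

fun Pade_rec :: "int \<Rightarrow> int \<Rightarrow> int \<Rightarrow> nat \<Rightarrow> int" where
  "Pade_rec x u v 0 = u"
| "Pade_rec x u v (Suc 0) = v"
| "Pade_rec x u v (Suc (Suc n)) =
     (1 + (2 * int n + 3) * x) * Pade_rec x u v (Suc n) - (int n + 1)\<^sup>2 * x\<^sup>2 * Pade_rec x u v n"

definition Pade_num :: "int \<Rightarrow> nat \<Rightarrow> int" where
  "Pade_num x = Pade_rec x 0 1"

text \<open>For nonzero \<open>x\<close> this is \<open>n! x^n L_n(-1/x)\<close>, where
  \<open>L_n\<close> is the Laguerre polynomial.\<close>

definition Pade_den :: "int \<Rightarrow> nat \<Rightarrow> int" where
  "Pade_den x = Pade_rec x 1 (1 + x)"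

text \<open>Since \<open>\<bar>x\<bar>\<close> is at least 1, the induction step reduces to
  \<open>(2n+4) 4(n+1) + (n+1)^2 = (n+1)(9n+17)\<close>, which is at most
  \<open>16(n+1)(n+2)\<close>. This is the 4 in \<open>Euler_c\<close>.\<close>

lemma Pade_rec_bound:
  assumes x: "x \<noteq> 0" and u: "\<bar>u\<bar> \<le> 1" and v: "\<bar>v\<bar> \<le> 4 * \<bar>x\<bar>"
  shows "\<bar>Pade_rec x u v n\<bar> \<le> 4 ^ n * fact n * \<bar>x\<bar> ^ n"
proof (induction n rule: induct_nat_012)
  case (ge2 n)
  define y where "y = \<bar>x\<bar>"
  define C where "C = 4 ^ n * fact n * y ^ n"
  have y: "y \<ge> 1" using x by (simp add: y_def)
  have C: "C \<ge> 0" using y by (simp add: C_def)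
  have IH0: "\<bar>Pade_rec x u v n\<bar> \<le> C" using ge2(1) by (simp add: C_def y_def)
  have IH1: "\<bar>Pade_rec x u v (Suc n)\<bar> \<le> 4 * (int n + 1) * y * C"
    using ge2(2) by (simp add: C_def y_def algebra_simps)
  have f: "\<bar>1 + (2 * int n + 3) * x\<bar> \<le> (2 * int n + 4) * y"
  proof -
    have "\<bar>1 + (2 * int n + 3) * x\<bar> \<le> 1 + \<bar>(2 * int n + 3) * x\<bar>" by linarith
    also have "\<bar>(2 * int n + 3) * x\<bar> = (2 * int n + 3) * y" by (simp add: abs_mult y_def)
    finally show ?thesis using y by (simp add: algebra_simps)
  qed
  have "\<bar>Pade_rec x u v (Suc (Suc n))\<bar> \<le>
      \<bar>(1 + (2 * int n + 3) * x) * Pade_rec x u v (Suc n)\<bar> + \<bar>(int n + 1)\<^sup>2 * x\<^sup>2 * Pade_rec x u v n\<bar>"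
    unfolding Pade_rec.simps by (rule abs_triangle_ineq4)
  also have "\<dots> = \<bar>1 + (2 * int n + 3) * x\<bar> * \<bar>Pade_rec x u v (Suc n)\<bar> +
      (int n + 1)\<^sup>2 * y\<^sup>2 * \<bar>Pade_rec x u v n\<bar>"
    by (simp add: abs_mult y_def)
  also have "\<dots> \<le> ((2 * int n + 4) * y) * (4 * (int n + 1) * y * C) + (int n + 1)\<^sup>2 * y\<^sup>2 * C"
    using f IH0 IH1 y by (intro add_mono mult_mono mult_left_mono) auto
  also have "\<dots> = (int n + 1) * (y\<^sup>2 * C) * (9 * int n + 17)"
    by (simp add: power2_eq_square algebra_simps)
  also have "\<dots> \<le> (int n + 1) * (y\<^sup>2 * C) * (16 * (int n + 2))"
    using C by (intro mult_left_mono) auto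
  also have "\<dots> = 4 ^ Suc (Suc n) * fact (Suc (Suc n)) * y ^ Suc (Suc n)"
    by (simp add: C_def power2_eq_square algebra_simps)
  finally show ?case by (simp add: y_def)
qed (use u v in auto)

lemma Pade_num_bound: "x \<noteq> 0 \<Longrightarrow> \<bar>Pade_num x n\<bar> \<le> 4 ^ n * fact n * \<bar>x\<bar> ^ n"
  unfolding Pade_num_def by (rule Pade_rec_bound) auto

lemma Pade_den_bound: "x \<noteq> 0 \<Longrightarrow> \<bar>Pade_den x n\<bar> \<le> 4 ^ n * fact n * \<bar>x\<bar> ^ n"
  unfolding Pade_den_def by (rule Pade_rec_bound) auto

text \<open>This is the Casoratian of two solutions: each step of the recurrence multiplies it by
  \<open>(n+1)^2 x^2\<close>, the coefficient of the oldest term.\<close>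

lemma Pade_determinant:
  "Pade_num x (Suc n) * Pade_den x n - Pade_num x n * Pade_den x (Suc n) = (fact n)\<^sup>2 * x ^ (2 * n)"
proof (induction n)
  case 0
  show ?case by (simp add: Pade_num_def Pade_den_def)
next
  case (Suc n)
  have "Pade_num x (Suc (Suc n)) * Pade_den x (Suc n) - Pade_num x (Suc n) * Pade_den x (Suc (Suc n)) =
      (int n + 1)\<^sup>2 * x\<^sup>2 * (Pade_num x (Suc n) * Pade_den x n - Pade_num x n * Pade_den x (Suc n))"
    by (simp add: Pade_num_def Pade_den_def algebra_simps)
  then show ?case unfolding Suc by (simp add: power2_eq_square algebra_simps)
qed

text \<open>The factor \<open>fact n * int (m choose n)\<close> is a falling factorial of
  \<open>m\<close>, so terms with \<open>m < n\<close> vanish; \<open>n = 0\<close> gives the terms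
  of Euler's series.\<close>

definition Pade_remainder_term :: "int \<Rightarrow> nat \<Rightarrow> nat \<Rightarrow> int" where
  "Pade_remainder_term x n m = fact m * (fact n * int (m choose n)) * (- x) ^ m * (- x) ^ n"

lemma falling_factorial_step:
  "fact (Suc n) * int (m choose Suc n) = (int m - int n) * (fact n * int (m choose n))"
proof -
  have "int (Suc n * (Suc m choose Suc n)) = int (Suc m * (m choose n))"
    by (simp only: Suc_times_binomial)
  then have "(int n + 1) * int (m choose Suc n) = (int m - int n) * int (m choose n)"
    by (simp add: algebra_simps)
  then have "fact n * ((int n + 1) * int (m choose Suc n)) =
      fact n * ((int m - int n) * int (m choose n))" by simp
  then show ?thesis by (simp add: algebra_simps)
qed

lemma falling_factorial_step_both:
  "fact (Suc n) * int (Suc m choose Suc n) = (int m + 1) * (fact n * int (m choose n))"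
proof -
  have "int (Suc n * (Suc m choose Suc n)) = int (Suc m * (m choose n))"
    by (simp only: Suc_times_binomial)
  then have "fact n * ((int n + 1) * int (Suc m choose Suc n)) =
      fact n * ((int m + 1) * int (m choose n))" by (simp add: algebra_simps)
  then show ?thesis by (simp add: algebra_simps)
qed

text \<open>This is \<open>(1 + x) E - 1\<close> term by term: the shifted terms sum to
  \<open>E - 1\<close>.\<close>

lemma Pade_remainder_term_1:
  "Pade_remainder_term x 1 m = Pade_remainder_term x 0 (Suc m) + x * Pade_remainder_term x 0 m"
  by (simp add: Pade_remainder_term_def algebra_simps)

text \<open>Up to common factors this is
  \<open>(m-n-1)(m-n) = (m+1)^2 - (2n+3)(m-n) - (n+1)^2\<close>. The shift to \<open>Suc m\<close>
  stands in for the coefficient 1 of the recurrence.\<close>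

lemma Pade_remainder_term_rec:
  "Pade_remainder_term x (Suc (Suc n)) m =
     Pade_remainder_term x (Suc n) (Suc m) + (2 * int n + 3) * x * Pade_remainder_term x (Suc n) m
     - (int n + 1)\<^sup>2 * x\<^sup>2 * Pade_remainder_term x n m"
proof -
  define F where "F = fact n * int (m choose n)"
  have 1: "fact (Suc n) * int (m choose Suc n) = (int m - int n) * F"
    unfolding F_def by (rule falling_factorial_step)
  have 2: "fact (Suc (Suc n)) * int (m choose Suc (Suc n)) = (int m - int n - 1) * ((int m - int n) * F)"
    unfolding falling_factorial_step[of "Suc n"] 1 by simp
  have 3: "fact (Suc n) * int (Suc m choose Suc n) = (int m + 1) * F"
    unfolding F_def by (rule falling_factorial_step_both)
  have 4: "(fact (Suc m) :: int) = (int m + 1) * fact m" by simp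
  show ?thesis
    unfolding Pade_remainder_term_def 1 2 3 4 F_def[symmetric] power_Suc
    by (simp add: algebra_simps power2_eq_square)
qed

text \<open>One \<open>fact n\<close> is explicit and the other divides \<open>fact m\<close>; each
  of the two powers of \<open>- x\<close> supplies \<open>x ^ n\<close>.\<close>

lemma fact_sq_dvd_Pade_remainder_term:
  "(fact n)\<^sup>2 * x ^ (2 * n) dvd Pade_remainder_term x n m"
proof (cases "n \<le> m")
  case True
  have 1: "(fact n :: int) dvd fact m" using True by (rule fact_dvd)
  have 2: "x ^ n dvd (- x) ^ m"
    using True by (metis dvd_minus_iff dvd_power_le dvd_refl minus_dvd_iff)
  have 3: "x ^ n dvd (- x) ^ n" by (simp add: dvd_power_same)
  have "fact n * (fact n * 1) * x ^ n * x ^ n dvd Pade_remainder_term x n m"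
    unfolding Pade_remainder_term_def using 1 2 3 by (intro mult_dvd_mono) auto
  then show ?thesis by (simp add: power2_eq_square mult_2 power_add mult.assoc)
next
  case False
  then show ?thesis by (simp add: Pade_remainder_term_def binomial_eq_0)
qed

text \<open>Truncating the remainder series at \<open>N\<close> costs boundary terms, all divisible by \<open>N!\<close>.\<close>

lemma fact_dvd_Pade_remainder_error:
  "fact N dvd Pade_den x n * (\<Sum>m<N. Pade_remainder_term x 0 m) - Pade_num x n
     - (\<Sum>m<N. Pade_remainder_term x n m)"
proof (induction n rule: induct_nat_012)
  case 0
  then show ?case by (simp add: Pade_den_def Pade_num_def)
next
  case 1
  \<comment> \<open>The shift loses the term at \<open>m = 0\<close>, which is 1 and accounts for
    \<open>Pade_num x 1 = 1\<close>.\<close>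
  have "(\<Sum>m<N. Pade_remainder_term x 0 (Suc m)) =
      (\<Sum>m<N. Pade_remainder_term x 0 m) + Pade_remainder_term x 0 N - 1"
    using sum.lessThan_Suc_shift[of "Pade_remainder_term x 0" N]
    by (simp add: Pade_remainder_term_def)
  then have "Pade_den x (Suc 0) * (\<Sum>m<N. Pade_remainder_term x 0 m) - Pade_num x (Suc 0)
      - (\<Sum>m<N. Pade_remainder_term x (Suc 0) m) = - Pade_remainder_term x 0 N"
    using Pade_remainder_term_1[of x]
    by (simp add: Pade_den_def Pade_num_def sum.distrib sum_distrib_left algebra_simps)
  then show ?case by (simp add: Pade_remainder_term_def)
next
  case (ge2 n)
  let ?T = "\<lambda>n. \<Sum>m<N. Pade_remainder_term x n m"
  let ?e = "\<lambda>n. Pade_den x n * ?T 0 - Pade_num x n - ?T n"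
  \<comment> \<open>Here the lost term is zero because \<open>0 choose Suc n = 0\<close>.\<close>
  have "(\<Sum>m<N. Pade_remainder_term x (Suc n) (Suc m)) = ?T (Suc n) + Pade_remainder_term x (Suc n) N"
    using sum.lessThan_Suc_shift[of "Pade_remainder_term x (Suc n)" N]
    by (simp add: Pade_remainder_term_def)
  then have T: "?T (Suc (Suc n)) = ?T (Suc n) + Pade_remainder_term x (Suc n) N
      + (2 * int n + 3) * x * ?T (Suc n) - (int n + 1)\<^sup>2 * x\<^sup>2 * ?T n"
    by (simp only: Pade_remainder_term_rec sum.distrib sum_subtractf sum_distrib_left)
  have "?e (Suc (Suc n)) = (1 + (2 * int n + 3) * x) * ?e (Suc n)
      - (int n + 1)\<^sup>2 * x\<^sup>2 * ?e n - Pade_remainder_term x (Suc n) N"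
    unfolding T by (simp add: Pade_den_def Pade_num_def algebra_simps)
  moreover have "fact N dvd Pade_remainder_term x (Suc n) N"
    by (simp add: Pade_remainder_term_def)
  ultimately show ?case using ge2 by (metis dvd_diff dvd_mult)
qed

text \<open>The size of \<open>N\<close> makes the modulus divide \<open>fact N\<close>, and hence
  the truncation error.\<close>

lemma Pade_approximation:
  assumes N: "\<bar>(fact n)\<^sup>2 * x ^ (2 * n)\<bar> \<le> int N" and x: "x \<noteq> 0"
  shows "(fact n)\<^sup>2 * x ^ (2 * n) dvd Pade_den x n * (\<Sum>k<N. fact k * (- x) ^ k) - Pade_num x n"
proof -
  define M where "M = (fact n)\<^sup>2 * x ^ (2 * n)"
  have "M \<noteq> 0" using x by (simp add: M_def)
  then have "nat \<bar>M\<bar> dvd fact N" using N unfolding M_def by (intro dvd_fact) linarith+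
  then have "int (nat \<bar>M\<bar>) dvd int (fact N)" by (simp only: int_dvd_int_iff)
  then have "M dvd fact N" by simp
  then have 1: "M dvd Pade_den x n * (\<Sum>m<N. Pade_remainder_term x 0 m) - Pade_num x n
      - (\<Sum>m<N. Pade_remainder_term x n m)"
    using fact_dvd_Pade_remainder_error dvd_trans by blast
  have 2: "M dvd (\<Sum>m<N. Pade_remainder_term x n m)"
    unfolding M_def by (intro dvd_sum fact_sq_dvd_Pade_remainder_term)
  have 3: "(\<Sum>m<N. Pade_remainder_term x 0 m) = (\<Sum>k<N. fact k * (- x) ^ k)"
    by (simp add: Pade_remainder_term_def)
  show ?thesis using dvd_add[OF 1 2] unfolding 3 M_def[symmetric] by simp
qed


subsection \<open>Absolute values of integers\<close>

lemma padic_abs_power: "prime p \<Longrightarrow> padic_abs p (x ^ n) = padic_abs p x ^ n"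
  by (induction n) (simp_all add: padic_abs_mult)

lemma padic_abs_of_int_le_1:
  assumes "prime p" shows "padic_abs p (of_int a) \<le> 1"
  using padic_abs_of_int_le_powi[OF assms, of 0 a] by simp

lemma padic_abs_of_int_dvd_mono:
  assumes p: "prime p" and "a dvd b"
  shows "padic_abs p (of_int b) \<le> padic_abs p (of_int a)"
proof -
  obtain c where "b = a * c" using assms by blast
  then show ?thesis
    using padic_abs_of_int_le_1[OF p, of c]
    by (simp add: padic_abs_mult[OF p] mult_left_le)
qed

text \<open>One half of the product formula: powers of distinct primes are coprime, so the product
  of those dividing \<open>d\<close> still divides \<open>d\<close>.\<close>

lemma abs_mult_prod_padic_abs_ge_1:
  assumes F: "finite F" "\<forall>p\<in>F. prime p" and d: "d \<noteq> 0"
  shows "1 \<le> \<bar>real_of_int d\<bar> * (\<Prod>p\<in>F. padic_abs p (of_int d))"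
proof -
  let ?m = "\<lambda>p. multiplicity (int p) d"
  have "(\<Prod>p\<in>F. int p ^ ?m p) dvd d"
    using F
  proof (induction F rule: finite_induct)
    case (insert q F)
    have "coprime (int q ^ ?m q) (\<Prod>p\<in>F. int p ^ ?m p)"
    proof (intro prod_coprime_right)
      fix p assume "p \<in> F"
      then have "coprime (int q) (int p)" using insert by (auto intro!: primes_coprime)
      then show "coprime (int q ^ ?m q) (int p ^ ?m p)" by simp
    qed
    then show ?case using insert by (simp add: divides_mult multiplicity_dvd)
  qed simp
  then have "(\<Prod>p\<in>F. int p ^ ?m p) \<le> \<bar>d\<bar>"
    using d by (intro zdvd_imp_le) auto
  then have "real_of_int (\<Prod>p\<in>F. int p ^ ?m p) \<le> real_of_int \<bar>d\<bar>" by (simp only: of_int_le_iff)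
  then have le: "(\<Prod>p\<in>F. real p ^ ?m p) \<le> \<bar>real_of_int d\<bar>" by simp
  have pos: "(\<Prod>p\<in>F. real p ^ ?m p) > 0"
    using F by (intro prod_pos) (auto dest: prime_gt_0_nat)
  have "(\<Prod>p\<in>F. padic_abs p (of_int d)) = (\<Prod>p\<in>F. inverse (real p ^ ?m p))"
    using F d by (intro prod.cong) (auto simp: padic_abs_of_int power_int_minus)
  also have "\<dots> = inverse (\<Prod>p\<in>F. real p ^ ?m p)"
    by (simp add: prod_inversef[symmetric] comp_def)
  finally have "(\<Prod>p\<in>F. padic_abs p (of_int d)) = inverse (\<Prod>p\<in>F. real p ^ ?m p)" .
  then show ?thesis using le pos by (simp add: divide_inverse[symmetric])
qed

lemma padic_abs_sq_prod_eq_prod: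
  assumes "finite F" "F \<subseteq> P" "{p \<in> P. padic_abs p x \<noteq> 1} \<subseteq> F"
  shows "padic_abs_sq_prod P x = (\<Prod>p\<in>F. (padic_abs p x)\<^sup>2)"
proof -
  have "padic_abs_sq_prod P x = prod' (\<lambda>p. (padic_abs p x)\<^sup>2) F"
    unfolding padic_abs_sq_prod_def
    using assms by (intro prod.mono_neutral_right') auto
  also have "\<dots> = (\<Prod>p\<in>F. (padic_abs p x)\<^sup>2)"
    using assms by (intro prod.eq_sum)
  finally show ?thesis .
qed

lemma padic_abs_sq_prod_bound:
  assumes P: "\<forall>p\<in>P. prime p" and d: "d \<noteq> 0" and x: "x \<noteq> 0"
    and le: "\<And>p. p \<in> P \<Longrightarrow> padic_abs p (of_int d) \<le> padic_abs p (of_int ((fact n)\<^sup>2 * x ^ (2 * n)))"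
  shows "1 \<le> \<bar>real_of_int d\<bar> * (padic_abs_sq_prod P (fact n) * padic_abs_sq_prod P (of_int x) ^ n)"
proof -
  \<comment> \<open>One finite set carries both infinite products. It may miss primes dividing
    \<open>d\<close>, since the lower bound holds over any finite set of primes.\<close>
  define F where "F = {p \<in> P. padic_abs p (fact n) \<noteq> 1} \<union> {p \<in> P. padic_abs p (of_int x) \<noteq> 1}"
  have F: "finite F" "F \<subseteq> P"
    using P x by (auto simp: F_def intro!: finite_padic_abs_neq_1)
  have "1 \<le> \<bar>real_of_int d\<bar> * (\<Prod>p\<in>F. padic_abs p (of_int d))"
    using F P d by (intro abs_mult_prod_padic_abs_ge_1) auto
  also have "\<dots> \<le> \<bar>real_of_int d\<bar> * (\<Prod>p\<in>F. padic_abs p (of_int ((fact n)\<^sup>2 * x ^ (2 * n))))"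
    using le F by (intro mult_left_mono prod_mono) auto
  also have "(\<Prod>p\<in>F. padic_abs p (of_int ((fact n)\<^sup>2 * x ^ (2 * n)))) =
      (\<Prod>p\<in>F. (padic_abs p (fact n))\<^sup>2 * ((padic_abs p (of_int x))\<^sup>2) ^ n)"
    using F P by (intro prod.cong) (auto simp: padic_abs_mult padic_abs_power power_mult subset_iff)
  also have "\<dots> = (\<Prod>p\<in>F. (padic_abs p (fact n))\<^sup>2) * (\<Prod>p\<in>F. (padic_abs p (of_int x))\<^sup>2) ^ n"
    by (simp add: prod.distrib prod_power_distrib)
  also have "\<dots> = padic_abs_sq_prod P (fact n) * padic_abs_sq_prod P (of_int x) ^ n"
    using F by (subst (1 2) padic_abs_sq_prod_eq_prod[of F]) (auto simp: F_def)
  finally show ?thesis .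
qed


subsection \<open>Linear forms in rational values of the series\<close>

lemma Euler_padic_rational_tendsto:
  assumes p: "prime p" and E: "Euler_padic p \<xi> = padic_of_rat p r"
  shows "(\<lambda>N. padic_abs p (of_int (\<Sum>k<N. fact k * (- \<xi>) ^ k) - r)) \<longlonglongrightarrow> 0"
  using E unfolding Euler_padic_eq[OF p] padic_of_rat_def padic_class_eq_iff[OF p]
  by (simp add: padic_null_seqs_def)

lemma padic_abs_linear_form_le:
  assumes p: "prime p" and \<xi>: "\<xi> \<noteq> 0" and b: "b \<noteq> 0"
    and E: "Euler_padic p \<xi> = padic_of_rat p (of_int a / of_int b)"
  shows "padic_abs p (of_int (a * Pade_den \<xi> n - b * Pade_num \<xi> n))
    \<le> padic_abs p (of_int ((fact n)\<^sup>2 * \<xi> ^ (2 * n)))"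
proof -
  define M where "M = (fact n)\<^sup>2 * \<xi> ^ (2 * n)"
  define S where "S = (\<lambda>N. \<Sum>k<N. fact k * (- \<xi>) ^ k)"
  define r :: rat where "r = of_int a / of_int b"
  let ?Q = "Pade_den \<xi> n" and ?A = "Pade_num \<xi> n"
  have "(\<lambda>N. padic_abs p (of_int (- b * ?Q)) * padic_abs p (of_int (S N) - r)) \<longlonglongrightarrow>
      padic_abs p (of_int (- b * ?Q)) * 0"
    unfolding S_def r_def by (intro tendsto_intros Euler_padic_rational_tendsto p E)
  moreover have "padic_abs p (of_int M) > 0"
  proof -
    have "(of_int M :: rat) \<noteq> 0" using \<xi> by (simp add: M_def)
    then have "padic_abs p (of_int M) \<noteq> 0" by (simp only: padic_abs_eq_0_iff[OF p] not_False_eq_True)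
    then show ?thesis using padic_abs_nonneg[of p "of_int M"] by linarith
  qed
  ultimately have "\<forall>\<^sub>F N in sequentially.
      padic_abs p (of_int (- b * ?Q)) * padic_abs p (of_int (S N) - r) < padic_abs p (of_int M)"
    by (intro order_tendstoD(2)) auto
  then have "\<forall>\<^sub>F N in sequentially. N \<ge> nat \<bar>M\<bar> \<and>
      padic_abs p (of_int (- b * ?Q)) * padic_abs p (of_int (S N) - r) < padic_abs p (of_int M)"
    using eventually_ge_at_top by (intro eventually_conj)
  then obtain N where N: "N \<ge> nat \<bar>M\<bar>" and small:
      "padic_abs p (of_int (- b * ?Q)) * padic_abs p (of_int (S N) - r) < padic_abs p (of_int M)"
    by (auto simp only: eventually_sequentially)
  have "M dvd ?Q * S N - ?A"
    unfolding M_def S_def by (rule Pade_approximation) (use N \<xi> in \<open>auto simp: M_def\<close>)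
  then have 1: "padic_abs p (of_int (b * (?Q * S N - ?A))) \<le> padic_abs p (of_int M)"
    by (intro padic_abs_of_int_dvd_mono p) simp
  \<comment> \<open>The first summand is divisible by \<open>M\<close>; the second is small because
    the partial sums tend to \<open>r\<close>.\<close>
  have "of_int (a * ?Q - b * ?A) =
      of_int (b * (?Q * S N - ?A)) + of_int (- b * ?Q) * (of_int (S N) - r)"
    using b by (simp add: r_def field_simps)
  then have "padic_abs p (of_int (a * ?Q - b * ?A)) \<le> max (padic_abs p (of_int (b * (?Q * S N - ?A))))
      (padic_abs p (of_int (- b * ?Q) * (of_int (S N) - r)))"
    using padic_abs_add_ultra[OF p] by metis
  then show ?thesis using 1 small unfolding padic_abs_mult[OF p] M_def by linarith
qed

lemma linear_form_bound:
  assumes "\<xi> \<noteq> 0"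
  shows "\<bar>real_of_int (a * Pade_den \<xi> n - b * Pade_num \<xi> n)\<bar> \<le>
    (\<bar>real_of_int a\<bar> + \<bar>real_of_int b\<bar>) * (4 ^ n * fact n * \<bar>real_of_int \<xi>\<bar> ^ n)"
proof -
  let ?C = "4 ^ n * fact n * \<bar>\<xi>\<bar> ^ n"
  have "\<bar>a * Pade_den \<xi> n - b * Pade_num \<xi> n\<bar> \<le> \<bar>a\<bar> * \<bar>Pade_den \<xi> n\<bar> + \<bar>b\<bar> * \<bar>Pade_num \<xi> n\<bar>"
    by (metis abs_mult abs_triangle_ineq4)
  also have "\<dots> \<le> \<bar>a\<bar> * ?C + \<bar>b\<bar> * ?C"
    using assms by (intro add_mono mult_left_mono Pade_den_bound Pade_num_bound) auto
  finally have "\<bar>a * Pade_den \<xi> n - b * Pade_num \<xi> n\<bar> \<le> (\<bar>a\<bar> + \<bar>b\<bar>) * ?C"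
    by (simp add: algebra_simps)
  then have "real_of_int \<bar>a * Pade_den \<xi> n - b * Pade_num \<xi> n\<bar> \<le> real_of_int ((\<bar>a\<bar> + \<bar>b\<bar>) * ?C)"
    by (simp only: of_int_le_iff)
  then show ?thesis by simp
qed

text \<open>If both forms vanished, eliminating \<open>a\<close> would make \<open>b\<close> times
  the nonzero determinant vanish.\<close>

lemma linear_form_nonzero:
  assumes "\<xi> \<noteq> 0" "b \<noteq> 0"
  obtains m where "m \<in> {n, Suc n}" "a * Pade_den \<xi> m - b * Pade_num \<xi> m \<noteq> 0"
proof -
  have "b * (Pade_num \<xi> (Suc n) * Pade_den \<xi> n - Pade_num \<xi> n * Pade_den \<xi> (Suc n)) =
      Pade_den \<xi> (Suc n) * (a * Pade_den \<xi> n - b * Pade_num \<xi> n)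
      - Pade_den \<xi> n * (a * Pade_den \<xi> (Suc n) - b * Pade_num \<xi> (Suc n))"
    by (simp add: algebra_simps)
  then have "a * Pade_den \<xi> n - b * Pade_num \<xi> n \<noteq> 0 \<or>
      a * Pade_den \<xi> (Suc n) - b * Pade_num \<xi> (Suc n) \<noteq> 0"
    unfolding Pade_determinant using assms by auto
  then show ?thesis using that by blast
qed

theorem theorem1:
  fixes \<xi> :: int and P :: "nat set"
  assumes "\<xi> \<noteq> 0"
    and "\<forall>p\<in>P. prime p"
    and "limsup (\<lambda>n. ereal (Euler_c \<xi> P ^ n * fact n * padic_abs_sq_prod P (fact n))) = 0"
  shows "(\<exists>p\<in>P. padic_irrational p (Euler_padic p \<xi>)) \<or>
    (\<exists>p\<in>P. \<exists>q\<in>P. p \<noteq> q \<and>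
      (\<exists>a b :: rat. Euler_padic p \<xi> = padic_of_rat p a \<and> Euler_padic q \<xi> = padic_of_rat q b \<and> a \<noteq> b))"
proof (rule ccontr)
  assume contra: "\<not> ?thesis"
  have "\<exists>r. Euler_padic p \<xi> = padic_of_rat p r" if "p \<in> P" for p
  proof -
    have "prime p" using assms(2) that by blast
    then have "Euler_padic p \<xi> \<in> carrier (padic_field p)"
      using Euler_padic_sums unfolding padic_sums_def by blast
    moreover have "\<not> padic_irrational p (Euler_padic p \<xi>)" using contra that by blast
    ultimately show ?thesis unfolding padic_irrational_def by auto
  qed
  then obtain R where R: "\<And>p. p \<in> P \<Longrightarrow> Euler_padic p \<xi> = padic_of_rat p (R p)" by metis
  have "R p = R q" if "p \<in> P" "q \<in> P" for p q using contra that R by metis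
  \<comment> \<open>For empty \<open>P\<close> any \<open>r\<close> will do.\<close>
  then obtain r where r: "\<And>p. p \<in> P \<Longrightarrow> Euler_padic p \<xi> = padic_of_rat p r" using R by metis
  obtain a b where b: "b \<noteq> 0" and rab: "r = of_int a / of_int b" by (rule rat_frac_cases)
  let ?K = "\<bar>real_of_int a\<bar> + \<bar>real_of_int b\<bar>"
  let ?f = "\<lambda>n. Euler_c \<xi> P ^ n * fact n * padic_abs_sq_prod P (fact n)"
  have K: "?K > 0" using b by simp
  \<comment> \<open>The threshold is chosen to contradict \<open>1 \<le> ?K * ?f m\<close>.\<close>
  have "\<forall>\<^sub>F n in sequentially. ereal (?f n) < ereal (1 / ?K)"
    using assms(3) K by (intro Limsup_lessD) simp
  then obtain n where n: "\<And>m. m \<ge> n \<Longrightarrow> ?f m < 1 / ?K"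
    by (auto simp: eventually_sequentially)
  \<comment> \<open>Either choice of \<open>m\<close> is at least \<open>n\<close>, so the threshold
    applies to it.\<close>
  obtain m where m: "m \<in> {n, Suc n}" and nz: "a * Pade_den \<xi> m - b * Pade_num \<xi> m \<noteq> 0"
    using linear_form_nonzero[OF assms(1) b] by blast
  let ?d = "a * Pade_den \<xi> m - b * Pade_num \<xi> m"
  let ?\<pi> = "padic_abs_sq_prod P (fact m) * padic_abs_sq_prod P (of_int \<xi>) ^ m"
  have ge1: "1 \<le> \<bar>real_of_int ?d\<bar> * ?\<pi>"
    using assms(1,2) nz b r
    by (intro padic_abs_sq_prod_bound padic_abs_linear_form_le) (auto simp: rab)
  have "?\<pi> \<ge> 0"
  proof (rule ccontr)
    assume "\<not> ?\<pi> \<ge> 0"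
    then have "\<bar>real_of_int ?d\<bar> * ?\<pi> \<le> 0"
      by (intro mult_nonneg_nonpos[OF abs_ge_zero]) simp
    with ge1 show False by linarith
  qed
  then have "\<bar>real_of_int ?d\<bar> * ?\<pi> \<le> ?K * (4 ^ m * fact m * \<bar>real_of_int \<xi>\<bar> ^ m) * ?\<pi>"
    by (intro mult_right_mono linear_form_bound assms(1))
  also have "\<dots> = ?K * ?f m"
    by (simp add: Euler_c_def power_mult_distrib algebra_simps)
  also have "\<dots> < ?K * (1 / ?K)"
    using n[of m] m K by (intro mult_strict_left_mono) auto
  finally show False using ge1 K by simp
qed

end
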